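(* Let $\lambda$ be an ordinal number such that $\omega\leq\lambda<\aleph_1$ (that is, $\lambda$ is a countably infinite ordinal), and let $\mathcal{S}=\{\alpha_i\}_{i\in\lambda}$ be a sequence of ordinal numbers indexed by $\lambda$. Then the set $$T'(\mathcal{S})=\left\{\sum_{i\in\lambda}\alpha_{\varphi(i)}\ \middle|\ \varphi:\lambda\rightarrow\lambda\text{ is an injection}\right\}$$ is at most countable.
   Context: An ordinal $\lambda$ is identified with the set of ordinals smaller than $\lambda$, and $\aleph_1$ is identified with the first uncountable ordinal $\omega_1$. For a sequence of ordinals $\{\beta_i\}_{i\in\lambda}$ (repetitions allowed), $\sum_{i\in\lambda}\beta_i$ denotes the usual transfinite ordinal sum, i.e. the order type of the concatenation of the $\beta_i$ in the order of their indices; equivalently, it is $s_\lambda$, where $s_0=0$, $s_{i+1}=s_i+\beta_i$, and $s_\delta=\sup_{i<\delta}s_i$ for limit $\delta\le\lambda$. The map $\varphi$ is an arbitrary injective function of sets (not required to preserve order). "At most countable" means finite or countably infinite. *)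

theory Defs
  imports "HOL-Library.Countable_Set" "HOL-Library.FuncSet"
begin

unbundle cardinal_syntax

text \<open>
  Ordinals are given by well-order relations, considered up to isomorphism \<open>=o\<close>.
  The ordinal \<open>\<lambda>\<close> is a well-order \<open>L\<close>, its elements \<open>i \<in> \<lambda>\<close> are the elements of \<open>Field L\<close>,
  and a \<open>\<lambda>\<close>-sequence of ordinals is a family of well-orders indexed by \<open>Field L\<close>. Since well-orders
  are reflexive on their field, the empty relation represents 0.
\<close>

definition omega1 :: "nat set rel" where
  "omega1 = cardSuc natLeq"

text \<open>
  For a well-order \<open>r\<close>, the ordinal of \<open>r\<close> is its isomorphism class within its type.
  (For \<open>r\<close> not a well-order the class would be empty.)
\<close>

definition order_type :: "'a rel \<Rightarrow> 'a rel set" where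
  "order_type r = ordIso `` {r}"

text \<open>The concatenation of the orders \<open>\<beta> i\<close> in the order of their indices.\<close>

definition ordinal_sum :: "'i rel \<Rightarrow> ('i \<Rightarrow> 'a rel) \<Rightarrow> ('i \<times> 'a) rel" where
  "ordinal_sum L \<beta> =
     {((i, x), (j, y)). i \<in> Field L \<and> j \<in> Field L \<and> x \<in> Field (\<beta> i) \<and> y \<in> Field (\<beta> j) \<and>
        (i \<noteq> j \<and> (i, j) \<in> L \<or> i = j \<and> (x, y) \<in> \<beta> i)}"

definition rearranged_sums :: "'i rel \<Rightarrow> ('i \<Rightarrow> 'a rel) \<Rightarrow> ('i \<times> 'a) rel set set" where
  "rearranged_sums L \<alpha> =
     {order_type (ordinal_sum L (\<lambda>i. \<alpha> (\<phi> i))) | \<phi>.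
        \<phi> \<in> Field L \<rightarrow> Field L \<and> inj_on \<phi> (Field L)}"

lemma order_type_eq_iff:
  assumes "Well_order r" "Well_order s"
  shows "order_type r = order_type s \<longleftrightarrow> r =o s"
proof
  assume "order_type r = order_type s"
  moreover have "s \<in> order_type s"
    using ordIso_reflexive[OF assms(2)] by (simp add: order_type_def)
  ultimately have "s \<in> order_type r" by simp
  then show "r =o s" by (simp add: order_type_def)
next
  assume "r =o s"
  then show "order_type r = order_type s"
    unfolding order_type_def by (auto intro: ordIso_transitive ordIso_symmetric)
qed

lemma in_ordinal_sum_iff:
  "((i, x), (j, y)) \<in> ordinal_sum L \<beta> \<longleftrightarrow>
     i \<in> Field L \<and> j \<in> Field L \<and> x \<in> Field (\<beta> i) \<and> y \<in> Field (\<beta> j) \<and>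
     (i \<noteq> j \<and> (i, j) \<in> L \<or> i = j \<and> (x, y) \<in> \<beta> i)"
  by (simp add: ordinal_sum_def)

lemma Field_ordinal_sum:
  assumes "\<And>i. i \<in> Field L \<Longrightarrow> Well_order (\<beta> i)"
  shows "Field (ordinal_sum L \<beta>) = Sigma (Field L) (\<lambda>i. Field (\<beta> i))"
proof -
  have "((i, x), (i, x)) \<in> ordinal_sum L \<beta>" if "i \<in> Field L" "x \<in> Field (\<beta> i)" for i x
    using that assms[of i]
    by (auto simp: in_ordinal_sum_iff order_on_defs refl_on_def)
  then show ?thesis
    unfolding Field_def[of "ordinal_sum L \<beta>"]
    by (fastforce simp: in_ordinal_sum_iff)
qed

lemma Well_order_ordinal_sum:
  assumes L: "Well_order L" and \<beta>: "\<And>i. i \<in> Field L \<Longrightarrow> Well_order (\<beta> i)"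
  shows "Well_order (ordinal_sum L \<beta>)"
proof -
  let ?S = "ordinal_sum L \<beta>"
  have F: "Field ?S = Sigma (Field L) (\<lambda>i. Field (\<beta> i))"
    using \<beta> by (rule Field_ordinal_sum)
  have L': "refl_on (Field L) L" "trans L" "antisym L" "total_on (Field L) L" "wf (L - Id)"
    using L by (auto simp: order_on_defs)
  have \<beta>': "refl_on (Field (\<beta> i)) (\<beta> i)" "trans (\<beta> i)" "antisym (\<beta> i)"
    "total_on (Field (\<beta> i)) (\<beta> i)" "wf (\<beta> i - Id)" if "i \<in> Field L" for i
    using \<beta>[OF that] by (auto simp: order_on_defs)
  have "refl_on (Field ?S) ?S"
    unfolding F using \<beta>'(1) by (auto simp: refl_on_def in_ordinal_sum_iff)
  moreover have "?S \<subseteq> Field ?S \<times> Field ?S"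
    by (auto simp: Field_def)
  moreover have "trans ?S"
  proof (rule transI, clarify)
    fix i x j y k z
    assume "((i, x), (j, y)) \<in> ?S" "((j, y), (k, z)) \<in> ?S"
    then show "((i, x), (k, z)) \<in> ?S"
      using transD[OF L'(2), of i j k] antisymD[OF L'(3), of i j] transD[OF \<beta>'(2)[of i], of x y z]
      by (auto simp: in_ordinal_sum_iff)
  qed
  moreover have "antisym ?S"
  proof (rule antisymI, clarify)
    fix i x j y
    assume "((i, x), (j, y)) \<in> ?S" "((j, y), (i, x)) \<in> ?S"
    then show "i = j \<and> x = y"
      using antisymD[OF L'(3), of i j] antisymD[OF \<beta>'(3)[of i], of x y]
      by (auto simp: in_ordinal_sum_iff)
  qed
  moreover have "total_on (Field ?S) ?S"
  proof -
    have "((i, x), (j, y)) \<in> ?S \<or> ((j, y), (i, x)) \<in> ?S"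
      if "i \<in> Field L" "x \<in> Field (\<beta> i)" "j \<in> Field L" "y \<in> Field (\<beta> j)" "(i, x) \<noteq> (j, y)"
      for i x j y
      using that L'(4) \<beta>'(4)[of i] unfolding total_on_def in_ordinal_sum_iff by (cases "i = j") auto
    then show ?thesis unfolding F total_on_def by blast
  qed
  moreover have "wf (?S - Id)"
  proof (rule wf_subset)
    let ?B = "\<lambda>i. if i \<in> Field L then \<beta> i - Id else {}"
    have "wf (?B i)" for i using \<beta>'(5) by auto
    show "wf {((i, x), (j, y)). (i, j) \<in> L - Id \<or> i = j \<and> (x, y) \<in> ?B i}" (is "wf ?R")
    proof (rule wfUNIVI)
      fix P p
      assume IH: "\<forall>p. (\<forall>q. (q, p) \<in> ?R \<longrightarrow> P q) \<longrightarrow> P p"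
      have "\<forall>x. P (i, x)" for i
        using L'(5)
      proof (induction i rule: wf_induct_rule)
        case (less i)
        show ?case
        proof
          fix x
          show "P (i, x)"
            using \<open>wf (?B i)\<close>
          proof (induction x rule: wf_induct_rule)
            case inner: (less x)
            show ?case
              by (rule IH[rule_format]) (use less inner in auto)
          qed
        qed
      qed
      then show "P p" by (cases p) auto
    qed
  qed (auto simp: in_ordinal_sum_iff)
  ultimately show ?thesis
    by (simp add: order_on_defs)
qed

end

theory Submission
  imports Defs "HOL-Library.Countable_Set_Type"
begin

text \<open>
  Let \<open>S i\<close> be the set of the partial sums \<open>\<Sum>j<i. \<alpha> (\<phi> j)\<close> for all maps \<open>\<phi> : \<lambda> \<rightarrow> \<lambda>\<close>.
  Each element of \<open>S i\<close> is the supremum of the sums \<open>\<Sum>k\<le>j. \<alpha> (\<phi> k)\<close>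
  with \<open>j < i\<close>, which lie in \<open>{\<sigma> + \<alpha> k |\<sigma> k. \<sigma> \<in> S j}\<close>. A countable set \<open>C\<close> of ordinals has
  only countably many suprema of subsets, because the supremum \<open>s\<close> of a subset is determined by
  the least element of \<open>C\<close> exceeding \<open>s\<close>, if there is one. So \<open>S i\<close> is countable by transfinite
  induction on \<open>i \<le> \<lambda>\<close>.
\<close>

section \<open>Suprema over a countable set of ordinals\<close>

text \<open>Choosing a preimage in \<open>D\<close> for each value of \<open>h\<close> makes
  \<open>q\<close> factor through \<open>h\<close>. This serves to count order types by a coarser
  invariant \<open>h\<close>.\<close>

lemma countable_image_factor:
  assumes "countable (h ` D)"
    and "\<And>x y. x \<in> D \<Longrightarrow> y \<in> D \<Longrightarrow> h x = h y \<Longrightarrow> q x = q y"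
  shows "countable (q ` D)"
proof -
  have "q x = q (inv_into D h (h x))" if "x \<in> D" for x
    using that by (intro assms(2)) (auto simp: inv_into_into f_inv_into_f)
  then have "q ` D \<subseteq> (q \<circ> inv_into D h) ` h ` D"
    by (auto simp: image_iff)
  then show ?thesis
    using assms(1) by (meson countable_image countable_subset)
qed

text \<open>The last assumption says that \<open>r\<close> is a supremum of some \<open>B\<close>
  inside \<open>C\<close>, with competing bounds \<open>t\<close> taken from the type of
  \<open>r\<close>. Such an \<open>r\<close> is recovered up to isomorphism from the least element
  of \<open>C\<close> above it.\<close>

lemma countable_order_type_lubs:
  fixes C D :: "'a rel set"
  assumes C: "countable (order_type ` C)" "\<And>c. c \<in> C \<Longrightarrow> Well_order c"
    and D: "\<And>r. r \<in> D \<Longrightarrow> Well_order r"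
    and lub: "\<And>r. r \<in> D \<Longrightarrow> \<exists>B\<subseteq>C. (\<forall>b\<in>B. b \<le>o r) \<and>
      (\<forall>t :: 'a rel. Well_order t \<longrightarrow> (\<forall>b\<in>B. b \<le>o t) \<longrightarrow> r \<le>o t)"
  shows "countable (order_type ` D)"
proof -
  define least where
    "least r c \<longleftrightarrow> c \<in> C \<and> r <o c \<and> (\<forall>d\<in>C. r <o d \<longrightarrow> c \<le>o d)" for r c :: "'a rel"
  \<comment> \<open>A least element of \<open>C\<close> above \<open>r\<close> is unique only up to
    isomorphism, so \<open>h\<close> records its order type; \<open>None\<close> marks an
    \<open>r\<close> that no element of \<open>C\<close> exceeds.\<close>
  define h where
    "h r = (if \<exists>c\<in>C. r <o c then Some (order_type (SOME c. least r c)) else None)" for r :: "'a rel"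
  have least: "least r (SOME c. least r c)" if "\<exists>c\<in>C. r <o c" for r :: "'a rel"
  proof -
    have "\<exists>c\<in>{c \<in> C. r <o c}. \<forall>d. d <o c \<longrightarrow> d \<notin> {c \<in> C. r <o c}"
      using wf_ordLess that unfolding wf_eq_minimal by (metis (mono_tags, lifting) mem_Collect_eq)
    then have "\<exists>c. least r c"
      unfolding least_def using C(2) by (metis (mono_tags, lifting) mem_Collect_eq not_ordLess_iff_ordLeq)
    then show ?thesis by (rule someI_ex)
  qed
  have "(SOME c. least r c) \<in> C" if "\<exists>c\<in>C. r <o c" for r
    using least[OF that] by (simp add: least_def[of r "Eps (least r)"])
  then have "h ` D \<subseteq> insert None (Some ` order_type ` C)"
    by (auto simp: h_def)
  then have count: "countable (h ` D)"
    using C(1) by (meson countable_image countable_insert countable_subset)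
  \<comment> \<open>One inequality suffices, the roles of \<open>r\<close> and \<open>s\<close>
    being symmetric. It is enough that \<open>s\<close> bounds \<open>B\<close>: if
    \<open>s <o b\<close> for some \<open>b\<close> in \<open>B\<close>, the least \<open>c\<close>
    in \<open>C\<close> above \<open>s\<close> satisfies \<open>c \<le>o b\<close> and
    \<open>b \<le>o r\<close>, whereas equal values of \<open>h\<close> force \<open>c\<close> to be
    isomorphic to some \<open>d\<close> above \<open>r\<close>.\<close>
  have le: "r \<le>o s" if r: "r \<in> D" and s: "s \<in> D" and eq: "h r = h s" for r s
  proof -
    obtain B where B: "B \<subseteq> C" "\<forall>b\<in>B. b \<le>o r"
      "\<And>t :: 'a rel. Well_order t \<Longrightarrow> \<forall>b\<in>B. b \<le>o t \<Longrightarrow> r \<le>o t"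
      using lub[OF r] by blast
    show ?thesis
    proof (intro B(3) ballI D s)
      fix b assume b: "b \<in> B"
      show "b \<le>o s"
      proof (rule ccontr)
        assume "\<not> b \<le>o s"
        then have sb: "s <o b"
          using D[OF s] B(1) C(2) b not_ordLeq_iff_ordLess by blast
        define c where "c = (SOME c. least s c)"
        define d where "d = (SOME d. least r d)"
        have ex: "\<exists>c\<in>C. s <o c" using sb B(1) b by blast
        then have exr: "\<exists>c\<in>C. r <o c" using eq by (auto simp: h_def split: if_splits)
        have c: "least s c" and d: "least r d"
          unfolding c_def d_def using least ex exr by blast+
        have "order_type c = order_type d"
          using eq ex exr by (simp add: h_def c_def d_def)
        then have "c =o d"
          using c d C(2) order_type_eq_iff by (metis least_def)
        moreover have "c \<le>o r"
          using c sb b B(1,2) by (meson least_def ordLeq_transitive subsetD)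
        moreover have "r <o d" using d by (simp add: least_def)
        ultimately show False
          by (meson not_ordLeq_ordLess ordIso_symmetric ordLess_ordIso_trans)
      qed
    qed
  qed
  show ?thesis
  proof (rule countable_image_factor[OF count])
    fix r s assume "r \<in> D" "s \<in> D" "h r = h s"
    then show "order_type r = order_type s"
      using le[of r s] le[of s r] D by (simp add: order_type_eq_iff ordIso_iff_ordLeq)
  qed
qed

section \<open>Partial sums as initial segments\<close>

lemma Field_Restr_Well_order:
  assumes "Well_order L" "A \<subseteq> Field L"
  shows "Field (Restr L A) = A"
  using assms by (simp add: Refl_Field_Restr2 order_on_defs)

lemma Field_ordinal_sum_Restr:
  assumes "Well_order L" "A \<subseteq> Field L" "\<And>i. i \<in> Field L \<Longrightarrow> Well_order (\<beta> i)"
  shows "Field (ordinal_sum (Restr L A) \<beta>) = Sigma A (\<lambda>i. Field (\<beta> i))"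
  using Field_ordinal_sum[of "Restr L A" \<beta>] assms by (auto simp: Field_Restr_Well_order subset_iff)

text \<open>A predecessor of \<open>(i, x)\<close> in the sum has an index at most \<open>i\<close>,
  so its block again belongs to \<open>A\<close>. With \<open>ordinal_sum_Restr\<close> this lets
  partial sums be compared as initial segments of a single well-order.\<close>

lemma ofilter_ordinal_sum:
  assumes L: "Well_order L" and \<beta>: "\<And>i. i \<in> Field L \<Longrightarrow> Well_order (\<beta> i)"
    and A: "wo_rel.ofilter L A"
  shows "wo_rel.ofilter (ordinal_sum L \<beta>) (Sigma A (\<lambda>i. Field (\<beta> i)))"
proof -
  have L': "wo_rel L" and S': "wo_rel (ordinal_sum L \<beta>)"
    using L Well_order_ordinal_sum[OF L \<beta>] by (auto simp: wo_rel_def)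
  show ?thesis
    using A unfolding wo_rel.ofilter_def[OF L'] wo_rel.ofilter_def[OF S']
    by (auto simp: Field_ordinal_sum[OF \<beta>] under_def in_ordinal_sum_iff subset_iff)
qed

lemma ordinal_sum_Restr:
  assumes "Well_order L" "A \<subseteq> Field L"
  shows "ordinal_sum (Restr L A) \<beta> = Restr (ordinal_sum L \<beta>) (Sigma A (\<lambda>i. Field (\<beta> i)))"
  using assms(2) by (auto simp: ordinal_sum_def Field_Restr_Well_order[OF assms])

lemma ordinal_sum_mono:
  assumes L: "Well_order L" and \<beta>: "\<And>i. i \<in> Field L \<Longrightarrow> Well_order (\<beta> i)"
    and "wo_rel.ofilter L A" "wo_rel.ofilter L B" "A \<subseteq> B"
  shows "ordinal_sum (Restr L A) \<beta> \<le>o ordinal_sum (Restr L B) \<beta>"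
proof -
  have "A \<subseteq> Field L" "B \<subseteq> Field L"
    using assms by (auto simp: wo_rel.ofilter_def wo_rel_def)
  moreover have "Sigma A (\<lambda>i. Field (\<beta> i)) \<subseteq> Sigma B (\<lambda>i. Field (\<beta> i))"
    using assms(5) by blast
  ultimately show ?thesis
    using ofilter_subset_ordLeq[OF Well_order_ordinal_sum[OF L \<beta>]
        ofilter_ordinal_sum[OF L \<beta> assms(3)] ofilter_ordinal_sum[OF L \<beta> assms(4)]]
    by (simp add: ordinal_sum_Restr[OF L])
qed

text \<open>If \<open>t\<close> were smaller than the sum, it would be a proper initial segment cut
  off at some \<open>(j, x)\<close>, hence smaller than the partial sum through block
  \<open>j\<close>. Since \<open>under\<close> includes \<open>j\<close> itself, zero, successor and
  limit lengths need no separate treatment.\<close>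

lemma ordinal_sum_lub:
  assumes L: "Well_order L" and \<beta>: "\<And>i. i \<in> Field L \<Longrightarrow> Well_order (\<beta> i)"
    and t: "Well_order t" and ub: "\<And>j. j \<in> Field L \<Longrightarrow> ordinal_sum (Restr L (under L j)) \<beta> \<le>o t"
  shows "ordinal_sum L \<beta> \<le>o t"
proof (rule ccontr)
  let ?S = "ordinal_sum L \<beta>"
  have S: "Well_order ?S" using L \<beta> by (rule Well_order_ordinal_sum)
  assume "\<not> ?S \<le>o t"
  then have "t <o ?S" using S t not_ordLeq_iff_ordLess by blast
  then obtain p where p: "p \<in> Field ?S" "t =o Restr ?S (underS ?S p)"
    using ordLess_iff_ordIso_Restr[OF S t] by blast
  obtain j x where jx: "p = (j, x)" "j \<in> Field L" "x \<in> Field (\<beta> j)"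
    using p(1) by (auto simp: Field_ordinal_sum[OF \<beta>])
  let ?U = "Sigma (under L j) (\<lambda>i. Field (\<beta> i))"
  have "(j, j) \<in> L" using L jx(2) by (auto simp: order_on_defs refl_on_def)
  then have "p \<in> ?U" using jx by (auto simp: under_def)
  moreover have "underS ?S p \<subseteq> ?U" "p \<notin> underS ?S p"
    using \<open>(j, j) \<in> L\<close> jx(1) by (auto simp: underS_def under_def in_ordinal_sum_iff)
  moreover have "wo_rel.ofilter ?S ?U"
    using L by (intro ofilter_ordinal_sum \<beta>) (simp_all add: wo_rel.under_ofilter wo_rel_def)
  moreover have "wo_rel.ofilter ?S (underS ?S p)"
    using S by (simp add: wo_rel.underS_ofilter wo_rel_def)
  \<comment> \<open>The inequality is strict because \<open>p\<close> lies in \<open>?U\<close> but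
    not in its own strict segment.\<close>
  ultimately have "Restr ?S (underS ?S p) <o Restr ?S ?U"
    using ofilter_subset_ordLess[OF S] by blast
  then have "t <o ordinal_sum (Restr L (under L j)) \<beta>"
    using ordIso_ordLess_trans[OF p(2)] by (simp add: ordinal_sum_Restr[OF L] under_Field)
  then show False using ub[OF jx(2)] not_ordLess_ordLeq by blast
qed

text \<open>The sum through \<open>j\<close> is the sum below \<open>j\<close> plus the term at
  \<open>j\<close>. An isomorphism of the sums below \<open>j\<close> therefore extends by the
  identity on the common last block.\<close>

lemma ordinal_sum_under_cong:
  fixes \<beta> \<gamma> :: "'i \<Rightarrow> 'a rel"
  assumes L: "Well_order L"
    and \<beta>: "\<And>i. i \<in> Field L \<Longrightarrow> Well_order (\<beta> i)" and \<gamma>: "\<And>i. i \<in> Field L \<Longrightarrow> Well_order (\<gamma> i)"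
    and j: "j \<in> Field L" and eq: "\<beta> j = \<gamma> j"
    and iso: "ordinal_sum (Restr L (underS L j)) \<beta> =o ordinal_sum (Restr L (underS L j)) \<gamma>"
  shows "ordinal_sum (Restr L (under L j)) \<beta> =o ordinal_sum (Restr L (under L j)) \<gamma>"
proof -
  let ?s = "\<lambda>\<beta>. ordinal_sum (Restr L (underS L j)) \<beta>"
  let ?u = "\<lambda>\<beta>. ordinal_sum (Restr L (under L j)) \<beta>"
  have antisym: "\<And>a b. (a, b) \<in> L \<Longrightarrow> (b, a) \<in> L \<Longrightarrow> a = b" and refl: "(j, j) \<in> L"
    using L j by (auto simp: order_on_defs antisym_def refl_on_def)
  have under: "under L j = insert j (underS L j)" "j \<notin> underS L j"
    using refl by (auto simp: under_def underS_def)
  have sub: "underS L j \<subseteq> Field L" "under L j \<subseteq> Field L"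
    by (auto simp: under_def underS_def Field_def)
  have F: "Field (?s \<delta>) = Sigma (underS L j) (\<lambda>i. Field (\<delta> i))"
    "Field (?u \<delta>) = Field (?s \<delta>) \<union> {j} \<times> Field (\<delta> j)"
    if "\<forall>i\<in>Field L. Well_order (\<delta> i)" for \<delta> :: "'i \<Rightarrow> 'a rel"
    using that Field_ordinal_sum_Restr[OF L sub(1), of \<delta>] Field_ordinal_sum_Restr[OF L sub(2), of \<delta>]
    by (auto simp: under(1))
  \<comment> \<open>This exhibits \<open>?u \<delta>\<close> as the ordinal addition of
    \<open>\<delta> j\<close> on top of \<open>?s \<delta>\<close>: every earlier element precedes
    block \<open>j\<close>, and by antisymmetry of \<open>L\<close> nothing in block
    \<open>j\<close> precedes an earlier element.\<close>
  have in_u: "((a, x), (b, y)) \<in> ?u \<delta> \<longleftrightarrow>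
      (if b = j then a = j \<and> (x, y) \<in> \<delta> j \<or> (a, x) \<in> Field (?s \<delta>) \<and> y \<in> Field (\<delta> j)
       else ((a, x), (b, y)) \<in> ?s \<delta>)"
    if "\<forall>i\<in>Field L. Well_order (\<delta> i)" for \<delta> :: "'i \<Rightarrow> 'a rel" and a x b y
    using refl antisym[of j b] unfolding F[OF that] in_ordinal_sum_iff
      Field_Restr_Well_order[OF L sub(1)] Field_Restr_Well_order[OF L sub(2)]
    by (auto simp: underS_def under_def intro: FieldI1 FieldI2)
  have \<beta>': "\<forall>i\<in>Field L. Well_order (\<beta> i)" and \<gamma>': "\<forall>i\<in>Field L. Well_order (\<gamma> i)"
    using \<beta> \<gamma> by auto
  obtain f where f: "iso (?s \<beta>) (?s \<gamma>) f"
    using iso by (auto simp: ordIso_def)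
  then have bij: "bij_betw f (Field (?s \<beta>)) (Field (?s \<gamma>))"
    and f_iff: "\<And>p q. p \<in> Field (?s \<beta>) \<Longrightarrow> q \<in> Field (?s \<beta>) \<Longrightarrow>
      (p, q) \<in> ?s \<beta> \<longleftrightarrow> (f p, f q) \<in> ?s \<gamma>"
    by (auto simp: iso_iff2)
  have f_into: "fst (f p) \<noteq> j" "f p \<in> Field (?s \<gamma>)" if "p \<in> Field (?s \<beta>)" for p
    using bij_betwE[OF bij] that under(2) unfolding F(1)[OF \<gamma>'] by fastforce+
  have fst: "fst p \<noteq> j" if "p \<in> Field (?s \<beta>)" for p
    using that under(2) unfolding F(1)[OF \<beta>'] by auto
  define g where "g p = (if fst p = j then p else f p)" for p
  have "bij_betw g (Field (?s \<beta>)) (Field (?s \<gamma>))"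
    using bij by (rule bij_betw_cong[THEN iffD1, rotated]) (use fst in \<open>auto simp: g_def\<close>)
  moreover have "bij_betw g ({j} \<times> Field (\<beta> j)) ({j} \<times> Field (\<gamma> j))"
    unfolding eq by (auto simp: g_def bij_betw_def inj_on_def image_iff)
  moreover have "Field (?s \<gamma>) \<inter> {j} \<times> Field (\<gamma> j) = {}"
    using under(2) unfolding F(1)[OF \<gamma>'] by auto
  ultimately have "bij_betw g (Field (?u \<beta>)) (Field (?u \<gamma>))"
    unfolding F(2)[OF \<beta>'] F(2)[OF \<gamma>'] by (rule bij_betw_combine)
  moreover have "(p, q) \<in> ?u \<beta> \<longleftrightarrow> (g p, g q) \<in> ?u \<gamma>"
    if "p \<in> Field (?u \<beta>)" "q \<in> Field (?u \<beta>)" for p q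
  proof -
    obtain a x b y where pq: "p = (a, x)" "q = (b, y)" by (meson surj_pair)
    consider "q \<in> Field (?s \<beta>)" "p \<in> Field (?s \<beta>)" | "q \<in> Field (?s \<beta>)" "a = j"
      | "b = j" "y \<in> Field (\<beta> j)" "p \<in> Field (?s \<beta>)" | "b = j" "a = j"
      using \<open>p \<in> _\<close> \<open>q \<in> _\<close> unfolding F(2)[OF \<beta>'] pq by blast
    then show ?thesis
    proof cases
      case 1
      moreover obtain c z d w where "f p = (c, z)" "f q = (d, w)" by (meson surj_pair)
      ultimately show ?thesis
        using f_iff[of p q] f_into[of p] f_into[of q] fst[of p] fst[of q]
        by (auto simp: g_def pq in_u[OF \<beta>'] in_u[OF \<gamma>'])
    next
      \<comment> \<open>Here both sides of the equivalence are false, since \<open>p\<close> lies in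
        the last block and \<open>q\<close> below it.\<close>
      case 2
      have not_s: "((j, x), r) \<notin> ?s \<delta>" for r and \<delta> :: "'i \<Rightarrow> 'a rel"
        using under(2) sub by (cases r) (auto simp: in_ordinal_sum_iff Field_Restr_Well_order[OF L])
      obtain d w where "f q = (d, w)" by (meson surj_pair)
      with 2 not_s show ?thesis
        using f_into[of q] fst[of q] by (auto simp: g_def pq in_u[OF \<beta>'] in_u[OF \<gamma>'])
    next
      case 3
      obtain c z where "f p = (c, z)" by (meson surj_pair)
      with 3 show ?thesis
        using f_into[of p] fst[of p] by (auto simp: g_def pq in_u[OF \<beta>'] in_u[OF \<gamma>'] eq)
    next
      case 4
      then show ?thesis
        using under(2) by (simp add: g_def pq in_u[OF \<beta>'] in_u[OF \<gamma>'] F(1)[OF \<beta>'] F(1)[OF \<gamma>'] eq)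
    qed
  qed
  ultimately have "iso (?u \<beta>) (?u \<gamma>) g" by (simp add: iso_iff2)
  moreover have "Well_order (?u \<beta>)" "Well_order (?u \<gamma>)"
    using \<beta>' \<gamma>' sub(2)
    by (auto intro!: Well_order_ordinal_sum Well_order_Restr L
        simp: Field_Restr_Well_order[OF L sub(2)] subset_iff)
  ultimately show ?thesis by (auto simp: ordIso_def)
qed

section \<open>Counting the sums\<close>

lemma countable_Field_if_ordLess_omega1:
  assumes "L <o omega1"
  shows "countable (Field L)"
proof -
  \<comment> \<open>Passing from \<open>L\<close> to the cardinal of its field allows the successor
    property: a cardinal below \<open>cardSuc natLeq\<close> is at most
    \<open>natLeq\<close>.\<close>
  have "|Field L| \<le>o L"
    using assms by (intro card_of_least) (auto simp: ordLess_def)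
  then have "|Field L| <o cardSuc natLeq"
    using assms by (simp add: omega1_def ordLeq_ordLess_trans)
  then show ?thesis
    by (simp add: cardSuc_ordLeq_ordLess natLeq_Card_order card_of_Card_order countable_card_le_natLeq)
qed

lemma countable_ordinal_sums:
  fixes L :: "'i rel" and \<alpha> :: "'k \<Rightarrow> 'a rel"
  assumes L: "Well_order L" "countable (Field L)"
    and K: "countable K" "\<And>k. k \<in> K \<Longrightarrow> Well_order (\<alpha> k)"
  shows "countable ((\<lambda>\<phi>. order_type (ordinal_sum L (\<lambda>i. \<alpha> (\<phi> i)))) ` (Field L \<rightarrow> K))"
proof -
  \<comment> \<open>With \<open>K\<close> as the set of values of the maps,
    \<open>?T (underS L j)\<close> is the set \<open>S j\<close> of the overview and
    \<open>?T (Field L)\<close> the one for the whole length.\<close>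
  define P where "P A \<phi> = ordinal_sum (Restr L A) (\<lambda>i. \<alpha> (\<phi> i))" for A and \<phi> :: "'i \<Rightarrow> 'k"
  let ?\<Phi> = "Field L \<rightarrow> K"
  let ?T = "\<lambda>A. order_type ` P A ` ?\<Phi>"
  have \<alpha>: "Well_order (\<alpha> (\<phi> i))" if "\<phi> \<in> ?\<Phi>" "i \<in> Field L" for \<phi> i
    using that K(2) by auto
  have wo: "Well_order (P A \<phi>)" if "A \<subseteq> Field L" "\<phi> \<in> ?\<Phi>" for A \<phi>
    unfolding P_def using that
    by (intro Well_order_ordinal_sum Well_order_Restr L(1) \<alpha>)
      (auto simp: Field_Restr_Well_order[OF L(1)])
  have L': "wo_rel L" using L(1) by (simp add: wo_rel_def)
  \<comment> \<open>Used both for \<open>underS L j\<close> inside the induction and for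
    \<open>Field L\<close> at its end. The set \<open>?C\<close> collects partial sums over all
    maps, while the supremum for one \<phi> uses only the partial sums of that \<phi>.\<close>
  have lub: "countable (?T A)"
    if A: "wo_rel.ofilter L A" and IH: "\<And>j. j \<in> A \<Longrightarrow> countable (?T (under L j))" for A
  proof (rule countable_order_type_lubs)
    have sub: "A \<subseteq> Field L" and under: "\<And>j. j \<in> A \<Longrightarrow> under L j \<subseteq> A"
      using A by (auto simp: wo_rel.ofilter_def[OF L'])
    let ?C = "\<Union>j\<in>A. P (under L j) ` ?\<Phi>"
    show "countable (order_type ` ?C)"
      unfolding image_UN using IH countable_subset[OF sub L(2)] by (intro countable_UN) auto
    show "Well_order c" if "c \<in> ?C" for c
      using that by (auto intro!: wo[OF under_Field])
    show "Well_order r" if "r \<in> P A ` ?\<Phi>" for r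
      using that by (auto intro!: wo[OF sub])
    fix r assume "r \<in> P A ` ?\<Phi>"
    then obtain \<phi> where \<phi>: "\<phi> \<in> ?\<Phi>" "r = P A \<phi>" by blast
    let ?B = "(\<lambda>j. P (under L j) \<phi>) ` A"
    have "?B \<subseteq> ?C" using \<phi>(1) by blast
    moreover have "\<forall>b\<in>?B. b \<le>o r"
      unfolding \<phi>(2) P_def using A under \<phi>(1)
      by (auto intro!: ordinal_sum_mono L(1) \<alpha> wo_rel.under_ofilter L')
    moreover have "r \<le>o t" if t: "Well_order t" "\<forall>b\<in>?B. b \<le>o t" for t :: "('i \<times> 'a) rel"
      unfolding \<phi>(2) P_def
    proof (rule ordinal_sum_lub)
      show "Well_order (Restr L A)" using L(1) by (rule Well_order_Restr)
      show "Well_order (\<alpha> (\<phi> i))" if "i \<in> Field (Restr L A)" for i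
        using that \<alpha>[OF \<phi>(1)] sub by (auto simp: Field_Restr_Well_order[OF L(1) sub])
      fix j assume "j \<in> Field (Restr L A)"
      then have j: "j \<in> A" by (simp add: Field_Restr_Well_order[OF L(1) sub])
      then have "Restr (Restr L A) (under (Restr L A) j) = Restr L (under L j)"
        using ofilter_Restr_under[OF L(1) A j] under[OF j] by auto
      then show "ordinal_sum (Restr (Restr L A) (under (Restr L A) j)) (\<lambda>i. \<alpha> (\<phi> i)) \<le>o t"
        using t(2) j by (simp add: P_def)
    qed (rule t(1))
    ultimately show "\<exists>B\<subseteq>?C. (\<forall>b\<in>B. b \<le>o r) \<and>
        (\<forall>t :: ('i \<times> 'a) rel. Well_order t \<longrightarrow> (\<forall>b\<in>B. b \<le>o t) \<longrightarrow> r \<le>o t)"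
      by blast
  qed
  have "wf (L - Id)" using L(1) by (simp add: order_on_defs)
  \<comment> \<open>The induction concerns sums through \<open>j\<close>; sums strictly below
    \<open>j\<close> are suprema of sums through smaller indices, so \<open>lub\<close> supplies
    them.\<close>
  then have "j \<in> Field L \<longrightarrow> countable (?T (under L j))" for j
  proof (induction j rule: wf_induct_rule)
    case (less j)
    have sub: "underS L j \<subseteq> Field L" by (auto simp: underS_def Field_def)
    have "countable (?T (underS L j))"
    proof (rule lub)
      show "wo_rel.ofilter L (underS L j)" using L' by (rule wo_rel.underS_ofilter)
      show "countable (?T (under L i))" if "i \<in> underS L j" for i
        using less[of i] that sub by (auto simp: underS_def)
    qed
    then have "countable (?T (underS L j) \<times> K)" using K(1) by simp
    show ?case
    proof
      assume j: "j \<in> Field L"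
      \<comment> \<open>The sum through \<open>j\<close> depends only on this pair, which ranges
        over a subset of a product of two countable sets.\<close>
      let ?h = "\<lambda>\<phi>. (order_type (P (underS L j) \<phi>), \<phi> j)"
      have "countable (?h ` ?\<Phi>)"
        using j by (intro countable_subset[OF _ \<open>countable (?T (underS L j) \<times> K)\<close>]) auto
      then have "countable ((\<lambda>\<phi>. order_type (P (under L j) \<phi>)) ` ?\<Phi>)"
      proof (rule countable_image_factor)
        fix \<phi> \<psi> assume *: "\<phi> \<in> ?\<Phi>" "\<psi> \<in> ?\<Phi>" "?h \<phi> = ?h \<psi>"
        then have "P (underS L j) \<phi> =o P (underS L j) \<psi>"
          using wo sub by (simp add: order_type_eq_iff)
        then have "P (under L j) \<phi> =o P (under L j) \<psi>"
          unfolding P_def using * j by (intro ordinal_sum_under_cong L(1) \<alpha>) auto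
        then show "order_type (P (under L j) \<phi>) = order_type (P (under L j) \<psi>)"
          using * wo under_Field by (metis order_type_eq_iff)
      qed
      then show "countable (?T (under L j))" by (simp add: image_image)
    qed
  qed
  then have "countable (?T (Field L))"
    using lub[OF wo_rel.Field_ofilter[OF L']] by blast
  then show ?thesis
    by (simp add: P_def image_image Restr_Field)
qed

theorem theorem2p3:
  fixes L :: "'i rel" and \<alpha> :: "'i \<Rightarrow> 'a rel"
  assumes "Well_order L"
    and "natLeq \<le>o L" and "L <o omega1"
    and "\<And>i. i \<in> Field L \<Longrightarrow> Well_order (\<alpha> i)"
  shows "countable (rearranged_sums L \<alpha>)"
proof -
  have "countable (Field L)" using assms(3) by (rule countable_Field_if_ordLess_omega1)
  then have "countable ((\<lambda>\<phi>. order_type (ordinal_sum L (\<lambda>i. \<alpha> (\<phi> i)))) ` (Field L \<rightarrow> Field L))"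
    using assms by (intro countable_ordinal_sums) auto
  \<comment> \<open>The injections are among all maps from \<open>Field L\<close> to itself.\<close>
  then show ?thesis
    by (rule countable_subset[rotated]) (auto simp: rearranged_sums_def)
qed

end
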